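(* Let $G$ be a finite, simple, connected graph. Then $c_{cr}(G)=1$ if and only if $G$ is a tree.
   Context: Cheating Robot game on a finite, simple, connected graph $G$ with $k$ cops: first the cop player places $k$ cops on vertices of $G$, then the robot is placed on a vertex. A vertex may hold more than one token. Play then proceeds in rounds: in each round, first every cop moves to a vertex in its closed neighbourhood (so a cop may stay put), and then the robot, knowing the cops' moves, moves to a vertex in his closed neighbourhood (he may stay put). Both sides have perfect information about positions. The robot is captured if either (i) at the end of the robot's move a cop and the robot are on the same vertex, or (ii) on his move the robot traverses an edge that a cop traversed on the cops' immediately preceding move. (A cop moving onto the robot's vertex does not by itself end the game; the robot still gets his move.) The cops win if they capture the robot after finitely many rounds. $c_{cr}(G)$ is the least number of cops that have a strategy guaranteeing capture of the robot on $G$. *)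

theory Defs
  imports "Graph_Theory.Graph_Theory"
begin

(* Finite simple graphs are the symmetric loop-free pair digraphs of locale pair_graph: an edge
   {u, v} is represented by the two arcs (u, v) and (v, u). *)

(* The library predicate Digraph_Component.tree is unsuitable for symmetric digraphs, because it
   counts the closed walk u, v, u as a cycle.  Cycles of the undirected graph are the cycles with
   at least three arcs. *)
definition undirected_tree :: "'a pair_pre_digraph \<Rightarrow> bool" where
  "undirected_tree G \<longleftrightarrow>
     connected (with_proj G) \<and>
     \<not> (\<exists>p. pre_digraph.cycle (with_proj G) p \<and> 3 \<le> length p)"

definition closed_nbhd :: "'a pair_pre_digraph \<Rightarrow> 'a \<Rightarrow> 'a set" where
  "closed_nbhd G v = insert v {w. (v, w) \<in> parcs G}"

(* A list of length k records the positions of the cops; cop i sits on entry i. *)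
definition cop_placement :: "'a pair_pre_digraph \<Rightarrow> nat \<Rightarrow> 'a list \<Rightarrow> bool" where
  "cop_placement G k cs \<longleftrightarrow> length cs = k \<and> set cs \<subseteq> pverts G"

definition cop_move :: "'a pair_pre_digraph \<Rightarrow> 'a list \<Rightarrow> 'a list \<Rightarrow> bool" where
  "cop_move G cs cs' \<longleftrightarrow> list_all2 (\<lambda>c c'. c' \<in> closed_nbhd G c) cs cs'"

(* r 0 is the robot's initial vertex and r n his vertex after n rounds. *)
definition robot_play :: "'a pair_pre_digraph \<Rightarrow> (nat \<Rightarrow> 'a) \<Rightarrow> bool" where
  "robot_play G r \<longleftrightarrow> r 0 \<in> pverts G \<and> (\<forall>n. r (Suc n) \<in> closed_nbhd G (r n))"

(* In one round the cops move from cs to cs' and then the robot from r to r'.  The condition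
   (r, r') \<in> parcs G says that the robot does not stay put; the edge may have been traversed by
   the cop in either direction. *)
definition captured :: "'a pair_pre_digraph \<Rightarrow> 'a list \<Rightarrow> 'a list \<Rightarrow> 'a \<Rightarrow> 'a \<Rightarrow> bool" where
  "captured G cs cs' r r' \<longleftrightarrow>
     r' \<in> set cs' \<or>
     ((r, r') \<in> parcs G \<and> (\<exists>i < length cs. {cs ! i, cs' ! i} = {r, r'}))"

(* A cop strategy maps the robot's positions so far to the next cop positions: s [] is the initial
   placement and s [r 0, ..., r n] the positions after the cops' move in round n + 1, made when
   the robot is on r n. *)
definition cops_at :: "('a list \<Rightarrow> 'a list) \<Rightarrow> (nat \<Rightarrow> 'a) \<Rightarrow> nat \<Rightarrow> 'a list" where
  "cops_at s r n = s (map r [0..<n])"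

(* Moves are required to be legal in all rounds, also after a capture; this is no restriction,
   since cops may stay put. *)
definition cop_strategy :: "'a pair_pre_digraph \<Rightarrow> nat \<Rightarrow> ('a list \<Rightarrow> 'a list) \<Rightarrow> bool" where
  "cop_strategy G k s \<longleftrightarrow>
     cop_placement G k (s []) \<and>
     (\<forall>r. robot_play G r \<longrightarrow> (\<forall>n. cop_move G (cops_at s r n) (cops_at s r (Suc n))))"

definition cops_win :: "'a pair_pre_digraph \<Rightarrow> nat \<Rightarrow> bool" where
  "cops_win G k \<longleftrightarrow>
     (\<exists>s. cop_strategy G k s \<and>
       (\<forall>r. robot_play G r \<longrightarrow>
         (\<exists>n. captured G (cops_at s r n) (cops_at s r (Suc n)) (r n) (r (Suc n)))))"

definition cheating_robot_number :: "'a pair_pre_digraph \<Rightarrow> nat" where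
  "cheating_robot_number G = (LEAST k. cops_win G k)"

end

theory Submission
  imports Defs
begin

text \<open>
  On a tree one cop wins by always stepping along the edge that leads towards the robot.  When the
  cop is on \<open>c\<close> and the robot on \<open>r \<noteq> c\<close>, consider the territory of the robot, the component of
  \<open>r\<close> in \<open>G - c\<close>.  The cop steps to the neighbour \<open>c'\<close> of \<open>c\<close> in this territory.  The edge
  \<open>{c, c'}\<close> is a bridge, and the robot would be captured if he crossed it in the same round, so he
  stays in the old territory; and unless he is captured, his new territory is contained in the old
  one and has lost the vertex \<open>c'\<close> (lemma \<open>territory_shrinks\<close>).  This can happen only finitely
  often.

  If the graph has a cycle, the robot evades a single cop by staying on the cycle: he sits still
  until the cop moves onto his vertex.  The cop comes from at most one of the two neighbours of
  this vertex on the cycle, and the robot moves to the other one (lemma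
  \<open>robot_evades_single_cop\<close>).

  Since the cheating robot number is a least number, it also has to be known that some number
  of cops wins, which is seen by placing a cop on every vertex, and that zero cops do not win.
\<close>

section \<open>Bridges and cycles\<close>

text \<open>The arcs of the graph \<open>G - c\<close>.\<close>

definition arcs_avoiding :: "'a pair_pre_digraph \<Rightarrow> 'a \<Rightarrow> 'a rel" where
  "arcs_avoiding G c = {(x, y) \<in> parcs G. x \<noteq> c \<and> y \<noteq> c}"

text \<open>
  A simple path from \<open>v\<close> back to \<open>u\<close> that does not use the edge \<open>{u, v}\<close> has at least two arcs,
  so closing it with \<open>(u, v)\<close> gives a cycle with at least three.
\<close>

lemma edge_is_bridge_if_no_cycle:
  assumes "pair_graph G"
    and acyclic: "\<not> (\<exists>p. pre_digraph.cycle (with_proj G) p \<and> 3 \<le> length p)"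
    and uv: "(u, v) \<in> parcs G"
  shows "(v, u) \<notin> (parcs G - {(u, v), (v, u)})\<^sup>*"
proof
  assume vu: "(v, u) \<in> (parcs G - {(u, v), (v, u)})\<^sup>*"
  interpret G: pair_graph G by fact
  (* The graph without the edge {u, v}. *)
  define H where "H = \<lparr>pverts = pverts G, parcs = parcs G - {(u, v), (v, u)}\<rparr>"
  interpret H: pair_wf_digraph H
    by unfold_locales (auto simp: H_def dest: G.in_arcsD1 G.in_arcsD2)
  have v: "v \<in> pverts H" and u: "u \<in> pverts H" and "u \<noteq> v"
    using uv G.in_arcsD1 G.in_arcsD2 G.pair_no_loops[OF uv] by (auto simp: H_def)
  have "v \<rightarrow>\<^sup>*\<^bsub>with_proj H\<^esub> u"
    using vu
  proof (induction rule: rtrancl_induct)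
    case base
    then show ?case using v by (simp add: reachable_def)
  next
    case (step y z)
    then have "(y, z) \<in> parcs H" by (simp add: H_def)
    then show ?case by (rule H.reachable_adj_trans[OF step.IH])
  qed
  then obtain p where "H.apath v p u" by (auto simp: H.reachable_apath)
  then have p: "set p \<subseteq> parcs H" "pcas v p u" "distinct (pawalk_verts v p)"
    by (auto simp: H.apath_def H.awalk_def)
  have "2 \<le> length p"
  proof (rule ccontr)
    assume "\<not> 2 \<le> length p"
    then consider "p = []" | e where "p = [e]"
      by (cases p; cases "tl p") auto
    then show False
      using p \<open>u \<noteq> v\<close> by cases (auto simp: H_def)
  qed
  moreover have "G.cycle ((u, v) # p)"
    unfolding G.cycle_def G.awalk_def
    using p uv u by (auto simp: H_def)
  ultimately show False using acyclic by (metis Suc_le_mono length_Cons numeral_3_eq_3 numeral_2_eq_2)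
qed

text \<open>
  The only property of a cycle that the robot needs: the set of its vertices is nonempty, and each
  of its members has two distinct neighbours in it, that is, one besides any given vertex.
\<close>

lemma cycle_vertices_have_other_neighbour:
  assumes "pair_graph G"
    and "pre_digraph.cycle (with_proj G) p" and p3: "3 \<le> length p"
  obtains S where "S \<noteq> {}" and "S \<subseteq> pverts G"
    and "\<And>v c. v \<in> S \<Longrightarrow> \<exists>w \<in> S. w \<noteq> c \<and> (v, w) \<in> parcs G"
proof -
  interpret G: pair_graph G by fact
  obtain u where w: "G.awalk u p u" and "distinct (tl (G.awalk_verts u p))" and "p \<noteq> []"
    using assms(2) by (auto simp: G.cycle_def)
  then have dist: "distinct (map snd p)" and arcs: "set p \<subseteq> parcs G" and cas: "pcas u p u"
    using G.awalk_verts_conv'[of u p u] by (auto simp: G.awalk_def)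
  have fst_Suc: "fst (q ! Suc i) = snd (q ! i)" if "pcas x q y" "Suc i < length q" for x y q i
    using that
  proof (induction q arbitrary: x i)
    case (Cons e q)
    then show ?case by (cases i; cases q) auto
  qed simp
  have fst_0: "fst (p ! 0) = u" using cas \<open>p \<noteq> []\<close> by (cases p) auto
  have snd_last: "snd (q ! (length q - 1)) = y" if "pcas x q y" "q \<noteq> []" for x y q
    using that by (induction q arbitrary: x) (auto simp: nth_Cons' gr0_conv_Suc)
  have last_u: "snd (p ! (length p - 1)) = u" using snd_last[OF cas \<open>p \<noteq> []\<close>] .
  (* The vertices of the cycle are x 0, ..., x (n - 1), where the successor of x (n - 1) is x 0. *)
  define n where "n = length p"
  define x where "x i = snd (p ! i)" for i
  have inj: "x i \<noteq> x j" if "i < n" "j < n" "i \<noteq> j" for i j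
    using dist that by (metis n_def x_def length_map nth_eq_iff_index_eq nth_map)
  have arc: "(x i, x (Suc i)) \<in> parcs G" if "Suc i < n" for i
    using fst_Suc[OF cas, of i] that arcs nth_mem[of "Suc i" p]
    by (metis n_def x_def prod.collapse subsetD)
  have arc0: "(x (n - 1), x 0) \<in> parcs G"
    using fst_0 last_u arcs nth_mem[of 0 p] \<open>p \<noteq> []\<close>
    by (metis n_def x_def prod.collapse subsetD length_greater_0_conv)
  have sym: "(b, a) \<in> parcs G" if "(a, b) \<in> parcs G" for a b
    using that G.arcs_symmetric by blast
  have n3: "3 \<le> n" using p3 by (simp add: n_def)
  have two: "\<exists>j k. j < n \<and> k < n \<and> j \<noteq> k \<and> (x i, x j) \<in> parcs G \<and> (x i, x k) \<in> parcs G"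
    if i: "i < n" for i
  proof -
    consider "i = 0" | "i = n - 1" | j where "i = Suc j" "Suc i < n"
      using i by (cases i) fastforce+
    then show ?thesis
    proof cases
      case 1
      then show ?thesis using arc[of 0] sym[OF arc0] n3
        by (intro exI[of _ "Suc 0"] exI[of _ "n - 1"]) auto
    next
      case 2
      then show ?thesis using sym[OF arc[of "n - 2"]] arc0 n3
        by (intro exI[of _ 0] exI[of _ "n - 2"]) (auto simp: Suc_diff_le numeral_2_eq_2 Suc_diff_Suc)
    next
      case 3
      then show ?thesis using sym[OF arc[of j]] arc[of i]
        by (intro exI[of _ j] exI[of _ "Suc i"]) auto
    qed
  qed
  show thesis
  proof (rule that[of "x ` {..<n}"])
    show "x ` {..<n} \<noteq> {}" using n3 by (auto simp: lessThan_empty_iff)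
    show "x ` {..<n} \<subseteq> pverts G"
      using two G.in_arcsD1 by blast
    show "\<exists>w \<in> x ` {..<n}. w \<noteq> c \<and> (v, w) \<in> parcs G" if v: "v \<in> x ` {..<n}" for v c
    proof -
      from v obtain i where "i < n" "v = x i" by auto
      with two obtain j k where jk: "j < n" "k < n" "j \<noteq> k" "(v, x j) \<in> parcs G" "(v, x k) \<in> parcs G"
        by blast
      with inj have "x j \<noteq> c \<or> x k \<noteq> c" by metis
      with jk show ?thesis by auto
    qed
  qed
qed

section \<open>A single cop wins on a tree\<close>

lemma robot_play_in_pverts:
  assumes "pair_graph G" "robot_play G r"
  shows "r n \<in> pverts G"
proof -
  interpret pair_graph G by fact
  show ?thesis
  proof (induction n)
    case (Suc n)
    have "r (Suc n) \<in> closed_nbhd G (r n)" using assms(2) by (simp add: robot_play_def)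
    then show ?case using Suc in_arcsD2 by (auto simp: closed_nbhd_def)
  qed (use assms(2) in \<open>simp add: robot_play_def\<close>)
qed

lemma reachable_from_connected:
  assumes "connected (with_proj G)" "pair_graph G" "u \<in> pverts G" "v \<in> pverts G"
  shows "(u, v) \<in> (parcs G)\<^sup>*"
proof -
  interpret pair_graph G by fact
  have "strongly_connected (with_proj G)"
    using assms(1) sym_arcs by (rule symmetric_connected_imp_strongly_connected[rotated])
  then have "(u, v) \<in> rtrancl_on (pverts G) (parcs G)"
    using assms(3,4) by (auto simp: strongly_connected_def reachable_def)
  then show ?thesis by (rule rtrancl_on_rtranclI)
qed

text \<open>The step is the one that a walk from \<open>c\<close> to \<open>r\<close> makes when it leaves \<open>c\<close> for the last time.\<close>

lemma exists_step_towards: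
  assumes "(c, r) \<in> (parcs G)\<^sup>*" "c \<noteq> r"
  shows "\<exists>c'. (c, c') \<in> parcs G \<and> (c', r) \<in> (arcs_avoiding G c)\<^sup>*"
proof -
  have stuck: "(c, r) \<notin> (arcs_avoiding G c)\<^sup>*"
    using \<open>c \<noteq> r\<close> by (auto elim: converse_rtranclE simp: arcs_avoiding_def)
  have "(x, r) \<in> (arcs_avoiding G c)\<^sup>* \<or>
      (\<exists>c'. (c, c') \<in> parcs G \<and> (c', r) \<in> (arcs_avoiding G c)\<^sup>*)"
    if "(x, r) \<in> (parcs G)\<^sup>*" for x
    using that
  proof (induction rule: converse_rtrancl_induct)
    case (step x y)
    show ?case
    proof (cases "(y, r) \<in> (arcs_avoiding G c)\<^sup>*")
      case True
      with stuck have "y \<noteq> c" by metis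
      then have "x = c \<or> (x, y) \<in> arcs_avoiding G c"
        using step.hyps(1) by (simp add: arcs_avoiding_def)
      then show ?thesis
        using True step.hyps(1) by (metis converse_rtrancl_into_rtrancl)
    next
      case False
      with step.IH show ?thesis by metis
    qed
  qed simp
  with assms stuck show ?thesis by blast
qed

text \<open>
  The step of the cop from \<open>c\<close> towards the robot on \<open>r\<close>.  The cop stays put if there is no such
  step; in a loop-free graph this includes the case \<open>r = c\<close>.
\<close>

definition step_towards :: "'a pair_pre_digraph \<Rightarrow> 'a \<Rightarrow> 'a \<Rightarrow> 'a" where
  "step_towards G c r =
     (if \<exists>c'. (c, c') \<in> parcs G \<and> (c', r) \<in> (arcs_avoiding G c)\<^sup>*
      then SOME c'. (c, c') \<in> parcs G \<and> (c', r) \<in> (arcs_avoiding G c)\<^sup>*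
      else c)"

lemma step_towards_in_closed_nbhd: "step_towards G c r \<in> closed_nbhd G c"
proof (cases "\<exists>c'. (c, c') \<in> parcs G \<and> (c', r) \<in> (arcs_avoiding G c)\<^sup>*")
  case True
  from someI_ex[OF this] show ?thesis
    unfolding step_towards_def if_P[OF True] by (simp add: closed_nbhd_def)
next
  case False
  show ?thesis unfolding step_towards_def if_not_P[OF False] by (simp add: closed_nbhd_def)
qed

lemma step_towards:
  assumes "(c, r) \<in> (parcs G)\<^sup>*" "c \<noteq> r"
  shows "(c, step_towards G c r) \<in> parcs G"
    and "(step_towards G c r, r) \<in> (arcs_avoiding G c)\<^sup>*"
  using exists_step_towards[OF assms] someI_ex[OF exists_step_towards[OF assms]]
  by (auto simp: step_towards_def)

text \<open>The vertices of the component of \<open>r\<close> in \<open>G - c\<close>, for \<open>r \<noteq> c\<close>.\<close>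

definition territory :: "'a pair_pre_digraph \<Rightarrow> 'a \<Rightarrow> 'a \<Rightarrow> 'a set" where
  "territory G c r = {x. (r, x) \<in> (arcs_avoiding G c)\<^sup>*}"

lemma sym_arcs_avoiding:
  assumes "pair_graph G" "(x, y) \<in> (arcs_avoiding G c)\<^sup>*"
  shows "(y, x) \<in> (arcs_avoiding G c)\<^sup>*"
proof -
  interpret pair_graph G by fact
  have "sym (arcs_avoiding G c)"
    using arcs_symmetric by (auto simp: arcs_avoiding_def sym_def)
  then show ?thesis using assms(2) sym_rtrancl by (blast dest: symD)
qed

lemma territory_shrinks:
  assumes "pair_graph G"
    and acyclic: "\<not> (\<exists>p. pre_digraph.cycle (with_proj G) p \<and> 3 \<le> length p)"
    and cc': "(c, c') \<in> parcs G" and c'r: "(c', r) \<in> (arcs_avoiding G c)\<^sup>*"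
    and r': "r' \<in> closed_nbhd G r" and "r \<noteq> c" and "\<not> captured G [c] [c'] r r'"
  shows "territory G c' r' \<subset> territory G c r"
proof -
  interpret G: pair_graph G by fact
  let ?R = "parcs G - {(c, c'), (c', c)}"
  have bridge: "(c', c) \<notin> ?R\<^sup>*"
    by (rule edge_is_bridge_if_no_cycle[OF assms(1) acyclic cc'])
  have avoid: "(arcs_avoiding G c)\<^sup>* \<subseteq> ?R\<^sup>*" "(arcs_avoiding G c')\<^sup>* \<subseteq> ?R\<^sup>*"
    by (auto simp: arcs_avoiding_def intro!: rtrancl_mono)
  have "r' \<noteq> c'" and no_cross: "(r, r') \<in> parcs G \<Longrightarrow> {c, c'} \<noteq> {r, r'}"
    using assms(7) by (auto simp: captured_def)
  have "r' \<noteq> c"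
  proof
    assume "r' = c"
    with r' \<open>r \<noteq> c\<close> have rc: "(r, c) \<in> parcs G" by (auto simp: closed_nbhd_def)
    with no_cross \<open>r' = c\<close> have "(r, c) \<in> ?R" by auto
    with c'r avoid(1) have "(c', c) \<in> ?R\<^sup>*" by (meson rtrancl.rtrancl_into_rtrancl subsetD)
    with bridge show False by contradiction
  qed
  with r' \<open>r \<noteq> c\<close> have rr': "(r, r') \<in> (arcs_avoiding G c)\<^sup>*"
    by (auto simp: closed_nbhd_def arcs_avoiding_def)
  have c_out: "(r', c) \<notin> (arcs_avoiding G c')\<^sup>*"
  proof
    assume "(r', c) \<in> (arcs_avoiding G c')\<^sup>*"
    moreover have "(c', r') \<in> (arcs_avoiding G c)\<^sup>*" using c'r rr' by (rule rtrancl_trans)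
    ultimately have "(c', c) \<in> ?R\<^sup>*" using avoid by (meson rtrancl_trans subsetD)
    with bridge show False by contradiction
  qed
  have sub: "(r, x) \<in> (arcs_avoiding G c)\<^sup>*" if "(r', x) \<in> (arcs_avoiding G c')\<^sup>*" for x
    using that
  proof (induction rule: rtrancl_induct)
    case base
    show ?case by (rule rr')
  next
    case (step y z)
    have "(r', z) \<in> (arcs_avoiding G c')\<^sup>*" using step.hyps by (rule rtrancl_into_rtrancl)
    with step.hyps(1) c_out have "y \<noteq> c" "z \<noteq> c" by auto
    with step.hyps(2) have "(y, z) \<in> arcs_avoiding G c" by (simp add: arcs_avoiding_def)
    with step.IH show ?case by (rule rtrancl_into_rtrancl)
  qed
  have "c' \<in> territory G c r"
    using sym_arcs_avoiding[OF assms(1) c'r] by (simp add: territory_def)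
  moreover have "c' \<notin> territory G c' r'"
    using \<open>r' \<noteq> c'\<close> by (auto elim: rtranclE simp: territory_def arcs_avoiding_def)
  ultimately show ?thesis using sub by (auto simp: territory_def)
qed

lemma single_cop_wins_on_tree:
  assumes G: "pair_graph G" and conn: "connected (with_proj G)" and tree: "undirected_tree G"
  shows "cops_win G 1"
proof -
  interpret G: pair_graph G by fact
  have acyclic: "\<not> (\<exists>p. pre_digraph.cycle (with_proj G) p \<and> 3 \<le> length p)"
    using tree by (simp add: undirected_tree_def)
  obtain c0 where c0: "c0 \<in> pverts G"
    using conn by (auto simp: connected_conv)
  define s where "s h = [foldl (step_towards G) c0 h]" for h
  define c where "c r n = foldl (step_towards G) c0 (map r [0..<n])" for r n
  have at: "cops_at s r n = [c r n]" for r n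
    by (simp add: cops_at_def s_def c_def)
  have c_Suc: "c r (Suc n) = step_towards G (c r n) (r n)" for r n
    by (simp add: c_def)
  have "cop_strategy G 1 s"
    unfolding cop_strategy_def cop_placement_def at cop_move_def
    using c0 step_towards_in_closed_nbhd by (auto simp: s_def c_Suc)
  moreover have "\<exists>n. captured G (cops_at s r n) (cops_at s r (Suc n)) (r n) (r (Suc n))"
    if r: "robot_play G r" for r
  proof (rule ccontr)
    assume "\<nexists>n. captured G (cops_at s r n) (cops_at s r (Suc n)) (r n) (r (Suc n))"
    then have nc: "\<not> captured G [c r n] [c r (Suc n)] (r n) (r (Suc n))" for n
      by (simp add: at)
    have cV: "c r n \<in> pverts G" for n
    proof (induction n)
      case (Suc n)
      then show ?case
        using step_towards_in_closed_nbhd[of G "c r n" "r n"] G.in_arcsD2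
        by (auto simp: c_Suc closed_nbhd_def)
    qed (simp add: c_def c0)
    have rV: "r n \<in> pverts G" for n using robot_play_in_pverts[OF G r] .
    define T where "T n = territory G (c r (Suc n)) (r (Suc n))" for n
    (* In the first round the robot may start on the cop's vertex; from the second round on,
       the robot not having been captured, the two positions differ. *)
    have dec: "T (Suc n) \<subset> T n" for n
    proof -
      have ne: "c r (Suc n) \<noteq> r (Suc n)" using nc[of n] by (auto simp: captured_def)
      have reach: "(c r (Suc n), r (Suc n)) \<in> (parcs G)\<^sup>*"
        using reachable_from_connected[OF conn G cV rV] .
      have "r (Suc (Suc n)) \<in> closed_nbhd G (r (Suc n))"
        using r by (simp add: robot_play_def)
      with territory_shrinks[OF G acyclic step_towards[OF reach ne]] ne nc[of "Suc n"]
      show ?thesis by (auto simp: T_def c_Suc[of r "Suc n"])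
    qed
    have "x \<in> pverts G" if "(y, x) \<in> (arcs_avoiding G z)\<^sup>*" "y \<in> pverts G" for x y z
      using that by (induction rule: rtrancl_induct) (auto simp: arcs_avoiding_def dest: G.in_arcsD2)
    then have "T n \<subseteq> pverts G" for n
      using rV by (auto simp: T_def territory_def)
    then have fin: "finite (T n)" for n
      using G.pair_finite_verts finite_subset by blast
    have "card (T n) + n \<le> card (T 0)" for n
    proof (induction n)
      case (Suc n)
      then show ?case using psubset_card_mono[OF fin dec, of n] by simp
    qed simp
    from this[of "Suc (card (T 0))"] show False by simp
  qed
  ultimately show ?thesis by (auto simp: cops_win_def)
qed

section \<open>A robot on a cycle evades a single cop\<close>

text \<open>
  The robot never leaves \<open>S\<close>.  When the cop moves from \<open>c\<close> onto the robot's vertex \<open>v\<close>, any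
  neighbour of \<open>v\<close> in \<open>S\<close> other than \<open>c\<close> is safe, also when the cop was on \<open>v\<close> already, that is
  \<open>c = v\<close>.  So the robot can start anywhere in \<open>S\<close>.
\<close>

lemma robot_evades_single_cop:
  assumes "S \<noteq> {}" and "S \<subseteq> pverts G" and loopfree: "\<And>v. (v, v) \<notin> parcs G"
    and other: "\<And>v c. v \<in> S \<Longrightarrow> \<exists>w \<in> S. w \<noteq> c \<and> (v, w) \<in> parcs G"
  shows "\<not> cops_win G 1"
proof
  assume "cops_win G 1"
  then obtain s where strat: "cop_strategy G 1 s"
    and win: "\<And>r. robot_play G r \<Longrightarrow>
      \<exists>n. captured G (cops_at s r n) (cops_at s r (Suc n)) (r n) (r (Suc n))"
    by (auto simp: cops_win_def)
  obtain r0 where r0: "r0 \<in> S" using assms(1) by blast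
  (* The robot's answer on v when the cop moves from c to c'. *)
  define reply where
    "reply c c' v = (if c' \<noteq> v then v else SOME w. w \<in> S \<and> w \<noteq> c \<and> (v, w) \<in> parcs G)" for c c' v
  have reply: "reply c c' v \<in> S \<and> reply c c' v \<in> closed_nbhd G v \<and>
      \<not> captured G [c] [c'] v (reply c c' v)"
    if "v \<in> S" for c c' v
  proof (cases "c' = v")
    case True
    have "\<exists>w. w \<in> S \<and> w \<noteq> c \<and> (v, w) \<in> parcs G" using other[OF that] by blast
    from someI_ex[OF this] True
    have w: "reply c c' v \<in> S" "reply c c' v \<noteq> c" "(v, reply c c' v) \<in> parcs G"
      by (auto simp: reply_def)
    then have "reply c c' v \<noteq> v" using loopfree by metis
    with w True show ?thesis by (auto simp: captured_def closed_nbhd_def doubleton_eq_iff)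
  next
    case False
    with that loopfree show ?thesis by (auto simp: reply_def captured_def closed_nbhd_def)
  qed
  (* The play is defined together with its history, since the cop's moves depend on the latter. *)
  define hist where
    "hist = rec_nat [r0] (\<lambda>_ h. h @ [reply (hd (s (butlast h))) (hd (s h)) (last h)])"
  have hist_0: "hist 0 = [r0]"
    and hist_Suc: "hist (Suc n) =
      hist n @ [reply (hd (s (butlast (hist n)))) (hd (s (hist n))) (last (hist n))]" for n
    by (simp_all add: hist_def)
  define r where "r n = last (hist n)" for n
  have hist: "hist n = map r [0..<Suc n]" for n
  proof (induction n)
    case (Suc n)
    have "hist (Suc n) = hist n @ [r (Suc n)]" by (simp add: r_def hist_Suc)
    with Suc show ?case by simp
  qed (simp add: r_def hist_0)
  have r_Suc: "r (Suc n) = reply (hd (cops_at s r n)) (hd (cops_at s r (Suc n))) (r n)" for n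
  proof -
    have "r (Suc n) = reply (hd (s (butlast (hist n)))) (hd (s (hist n))) (r n)"
      by (simp add: r_def hist_Suc)
    moreover have "butlast (hist n) = map r [0..<n]" by (simp add: hist)
    ultimately show ?thesis by (simp only: cops_at_def hist)
  qed
  have rS: "r n \<in> S" for n
  proof (induction n)
    case 0
    show ?case by (simp add: r_def hist_0 r0)
  next
    case (Suc n)
    then show ?case using reply by (simp add: r_Suc)
  qed
  have play: "robot_play G r"
    unfolding robot_play_def using rS[of 0] reply[OF rS] assms(2) by (auto simp: r_Suc)
  have len: "length (cops_at s r n) = 1" for n
  proof (induction n)
    case 0
    then show ?case using strat by (simp add: cop_strategy_def cop_placement_def cops_at_def)
  next
    case (Suc n)
    have "cop_move G (cops_at s r n) (cops_at s r (Suc n))"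
      using strat play by (simp add: cop_strategy_def)
    with Suc show ?case by (metis cop_move_def list_all2_lengthD)
  qed
  have single: "cops_at s r n = [hd (cops_at s r n)]" for n
    using len[of n] by (cases "cops_at s r n") auto
  obtain n where "captured G (cops_at s r n) (cops_at s r (Suc n)) (r n) (r (Suc n))"
    using win[OF play] by blast
  with reply[OF rS, of "hd (cops_at s r n)" "hd (cops_at s r (Suc n))" n] show False
    using single[of n] single[of "Suc n"] by (simp add: r_Suc[of n])
qed

section \<open>The least number of cops\<close>

lemma cop_on_every_vertex_wins:
  assumes "pair_graph G"
  shows "cops_win G (card (pverts G))"
proof -
  interpret pair_graph G by fact
  obtain xs where xs: "set xs = pverts G" "length xs = card (pverts G)"
    using finite_distinct_list[OF pair_finite_verts] distinct_card by metis
  show ?thesis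
    unfolding cops_win_def
  proof (intro exI[of _ "\<lambda>_. xs"] conjI allI impI)
    show "cop_strategy G (card (pverts G)) (\<lambda>_. xs)"
      using xs by (auto simp: cop_strategy_def cop_placement_def cop_move_def cops_at_def
          closed_nbhd_def list_all2_same)
    show "\<exists>n. captured G (cops_at (\<lambda>_. xs) r n) (cops_at (\<lambda>_. xs) r (Suc n)) (r n) (r (Suc n))"
      if "robot_play G r" for r
      using robot_play_in_pverts[OF assms that] xs by (auto simp: captured_def cops_at_def)
  qed
qed

lemma zero_cops_lose:
  assumes "pverts G \<noteq> {}"
  shows "\<not> cops_win G 0"
proof
  assume "cops_win G 0"
  then obtain s where strat: "cop_strategy G 0 s"
    and win: "\<And>r. robot_play G r \<Longrightarrow>
      \<exists>n. captured G (cops_at s r n) (cops_at s r (Suc n)) (r n) (r (Suc n))"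
    by (auto simp: cops_win_def)
  obtain v where "v \<in> pverts G" using assms by blast
  then have play: "robot_play G (\<lambda>_. v)" by (simp add: robot_play_def closed_nbhd_def)
  have "cops_at s (\<lambda>_. v) n = []" for n
  proof (induction n)
    case 0
    then show ?case using strat by (simp add: cop_strategy_def cop_placement_def cops_at_def)
  next
    case (Suc n)
    have "cop_move G (cops_at s (\<lambda>_. v) n) (cops_at s (\<lambda>_. v) (Suc n))"
      using strat play by (simp add: cop_strategy_def)
    with Suc show ?case by (simp add: cop_move_def)
  qed
  with win[OF play] show False by (simp add: captured_def)
qed

theorem theorem2p6:
  fixes G :: "'a pair_pre_digraph"
  assumes "pair_graph G"
    and "connected (with_proj G)"
  shows "cheating_robot_number G = 1 \<longleftrightarrow> undirected_tree G"
proof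
  interpret G: pair_graph G by fact
  assume "cheating_robot_number G = 1"
  then have win: "cops_win G 1"
    using LeastI[of "cops_win G", OF cop_on_every_vertex_wins[OF assms(1)]]
    by (simp add: cheating_robot_number_def)
  show "undirected_tree G"
    unfolding undirected_tree_def
  proof (intro conjI assms(2) notI)
    assume "\<exists>p. pre_digraph.cycle (with_proj G) p \<and> 3 \<le> length p"
    then obtain p where p: "pre_digraph.cycle (with_proj G) p" "3 \<le> length p" by blast
    obtain S where "S \<noteq> {}" "S \<subseteq> pverts G"
      and "\<And>v c. v \<in> S \<Longrightarrow> \<exists>w \<in> S. w \<noteq> c \<and> (v, w) \<in> parcs G"
      using cycle_vertices_have_other_neighbour[OF assms(1) p] by blast
    moreover have "(v, v) \<notin> parcs G" for v using G.pair_no_loops[of "(v, v)"] by auto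
    ultimately have "\<not> cops_win G 1" by (intro robot_evades_single_cop)
    with win show False by contradiction
  qed
next
  assume "undirected_tree G"
  then have "cops_win G 1" by (rule single_cop_wins_on_tree[OF assms])
  moreover have "\<not> cops_win G 0"
    using assms(2) by (intro zero_cops_lose) (simp add: connected_conv)
  ultimately show "cheating_robot_number G = 1"
    unfolding cheating_robot_number_def
    by (intro Least_equality) (auto simp: Suc_le_eq intro: gr0I)
qed

end
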